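(* Let $\mathtt{finish}\ r$ be a single-clock program, i.e. $r$ contains no clocked finish, and let $\mathcal{A}$ be its set of advance instances. Then for every operation $x$ of the program, the phase number of $x$ is $$\phi(x) = \mathrm{Card}\{\, a\in\mathcal{A} \mid a\prec x \,\},$$ where $\prec$ is the unclocked happens-before relation.
   Context: **Programs.** Loops are assumed to have been statically expanded (for given values of the size parameters), and the heap is ignored. Statements are $s ::= b \mid \mathtt{advance} \mid \{s\ t\} \mid \mathtt{async}\ s \mid \mathtt{finish}\ s$, where the basic statements $b$ are all treated as $\mathtt{skip}$s carrying pairwise distinct names; the (named) basic statements of a program are its *operations*, and its occurrences of $\mathtt{advance}$ (also distinctly named) are its advance instances. "$r$ contains no clocked finish" means that no $\mathtt{advance}$ of $r$ lies inside a $\mathtt{finish}$ that occurs within $r$ (so all advances use the clock of the outer $\mathtt{finish}$). **Reduction.** A configuration is a statement or the terminated configuration $\mathtt{done}$. A statement is asynchronous if it is $\mathtt{async}\ s$, or $\{s\ t\}$ with $s$ and $t$ both asynchronous; otherwise it is synchronous. The relation $\longrightarrow$ is generated by: $b\longrightarrow\mathtt{done}$ for each basic statement $b$; if $s\longrightarrow s'$ then $\mathtt{async}\ s\longrightarrow\mathtt{async}\ s'$, $\mathtt{finish}\ s\longrightarrow\mathtt{finish}\ s'$, $\{s\ t\}\longrightarrow\{s'\ t\}$, and, when $t$ is asynchronous, $\{t\ s\}\longrightarrow\{t\ s'\}$; if $s\longrightarrow\mathtt{done}$ then $\mathtt{async}\ s\longrightarrow\mathtt{done}$, $\mathtt{finish}\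 s\longrightarrow\mathtt{done}$, $\{s\ t\}\longrightarrow t$, and, when $t$ is asynchronous, $\{t\ s\}\longrightarrow t$; and the *clock rule*: if $s$ is stuck and $s\Longrightarrow t$ then $\mathtt{finish}\ s\longrightarrow\mathtt{finish}\ t$. "Stuck" is the least predicate such that: $\mathtt{advance}$ is stuck; $\mathtt{async}\ s$ is stuck if $s$ is; $\{s\ t\}$ is stuck if $s$ is synchronous and stuck, or if $s$ is asynchronous and both $s$ and $t$ are stuck. The clock-step relation $\Longrightarrow$ is generated by: $\mathtt{advance}\Longrightarrow\mathtt{skip}$; $b\Longrightarrow b$; if $s\Longrightarrow t$ then $\mathtt{async}\ s\Longrightarrow\mathtt{async}\ t$, and $\{s\ u\}\Longrightarrow\{t\ u\}$ when $s$ is synchronous; if $s$ is asynchronous, $s\Longrightarrow s'$ and $t\Longrightarrow t'$, then $\{s\ t\}\Longrightarrow\{s'\ t'\}$. **Phases and unclocked happens-before.** An interpretation of a program is a complete reduction sequence from it to $\mathtt{done}$. For an operation $x$, $\phi(x)$ is the number of applications of the clock rule that precede the execution of $x$ in an interpretation (this does not depend on the interpretation). The unclocked relation $\prec$ is obtained by treating every $\mathtt{advance}$ as an ordinary named basic statement: for operations or advances $a,x$, $a\prec x$ iff $a$ is executed before $x$ in every interpretation of the program so modified. *)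

theory Defs
  imports Main
begin

datatype 'n stmt =
    Basic 'n
  | Advance 'n
  | Seq "'n stmt" "'n stmt"
  | Async "'n stmt"
  | Finish "'n stmt"

datatype 'n config = Done | Running "'n stmt"

fun operations :: "'n stmt \<Rightarrow> 'n set" where
  "operations (Basic b) = {b}"
| "operations (Advance a) = {}"
| "operations (Seq s t) = operations s \<union> operations t"
| "operations (Async s) = operations s"
| "operations (Finish s) = operations s"

fun advances :: "'n stmt \<Rightarrow> 'n set" where
  "advances (Basic b) = {}"
| "advances (Advance a) = {a}"
| "advances (Seq s t) = advances s \<union> advances t"
| "advances (Async s) = advances s"
| "advances (Finish s) = advances s"

fun names :: "'n stmt \<Rightarrow> 'n list" where
  "names (Basic b) = [b]"
| "names (Advance a) = [a]"
| "names (Seq s t) = names s @ names t"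
| "names (Async s) = names s"
| "names (Finish s) = names s"

text \<open>Operations and advance instances share one name space, and all occurrences
  in a program carry pairwise distinct names.\<close>

definition distinctly_named :: "'n stmt \<Rightarrow> bool" where
  "distinctly_named p \<longleftrightarrow> distinct (names p)"

fun no_clocked_finish :: "'n stmt \<Rightarrow> bool" where
  "no_clocked_finish (Basic b) \<longleftrightarrow> True"
| "no_clocked_finish (Advance a) \<longleftrightarrow> True"
| "no_clocked_finish (Seq s t) \<longleftrightarrow> no_clocked_finish s \<and> no_clocked_finish t"
| "no_clocked_finish (Async s) \<longleftrightarrow> no_clocked_finish s"
| "no_clocked_finish (Finish s) \<longleftrightarrow> advances s = {}"

fun asynchronous :: "'n stmt \<Rightarrow> bool" where
  "asynchronous (Async s) \<longleftrightarrow> True"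
| "asynchronous (Seq s t) \<longleftrightarrow> asynchronous s \<and> asynchronous t"
| "asynchronous (Basic b) \<longleftrightarrow> False"
| "asynchronous (Advance a) \<longleftrightarrow> False"
| "asynchronous (Finish s) \<longleftrightarrow> False"

abbreviation synchronous :: "'n stmt \<Rightarrow> bool" where
  "synchronous s \<equiv> \<not> asynchronous s"

inductive stuck :: "'n stmt \<Rightarrow> bool" where
  stuck_advance: "stuck (Advance a)"
| stuck_async: "stuck s \<Longrightarrow> stuck (Async s)"
| stuck_seq_sync: "synchronous s \<Longrightarrow> stuck s \<Longrightarrow> stuck (Seq s t)"
| stuck_seq_async: "asynchronous s \<Longrightarrow> stuck s \<Longrightarrow> stuck t \<Longrightarrow> stuck (Seq s t)"

text \<open>Basic statements are named skips; the skip replacing an advance inherits its name,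
  so that names stay pairwise distinct along a reduction.\<close>

inductive clock_step :: "'n stmt \<Rightarrow> 'n stmt \<Rightarrow> bool" where
  clock_advance: "clock_step (Advance a) (Basic a)"
| clock_basic: "clock_step (Basic b) (Basic b)"
| clock_async: "clock_step s t \<Longrightarrow> clock_step (Async s) (Async t)"
| clock_seq_sync: "synchronous s \<Longrightarrow> clock_step s t \<Longrightarrow> clock_step (Seq s u) (Seq t u)"
| clock_seq_async:
    "asynchronous s \<Longrightarrow> clock_step s s' \<Longrightarrow> clock_step t t' \<Longrightarrow> clock_step (Seq s t) (Seq s' t')"

text \<open>Every derivation of a reduction has exactly one leaf, which either executes a basic
  statement or applies the clock rule. The reduction is labelled with that event.\<close>

datatype 'n event = Exec 'n | Tick

inductive step :: "'n stmt \<Rightarrow> 'n event \<Rightarrow> 'n config \<Rightarrow> bool" where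
  step_basic: "step (Basic b) (Exec b) Done"
| step_async: "step s e (Running s') \<Longrightarrow> step (Async s) e (Running (Async s'))"
| step_finish: "step s e (Running s') \<Longrightarrow> step (Finish s) e (Running (Finish s'))"
| step_left: "step s e (Running s') \<Longrightarrow> step (Seq s t) e (Running (Seq s' t))"
| step_right:
    "asynchronous t \<Longrightarrow> step s e (Running s') \<Longrightarrow> step (Seq t s) e (Running (Seq t s'))"
| step_async_done: "step s e Done \<Longrightarrow> step (Async s) e Done"
| step_finish_done: "step s e Done \<Longrightarrow> step (Finish s) e Done"
| step_left_done: "step s e Done \<Longrightarrow> step (Seq s t) e (Running t)"
| step_right_done: "asynchronous t \<Longrightarrow> step s e Done \<Longrightarrow> step (Seq t s) e (Running t)"
| step_clock: "stuck s \<Longrightarrow> clock_step s t \<Longrightarrow> step (Finish s) Tick (Running (Finish t))"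

text \<open>The event sequences of the complete reduction sequences from a configuration.\<close>

inductive complete_run :: "'n config \<Rightarrow> 'n event list \<Rightarrow> bool" where
  complete_done: "complete_run Done []"
| complete_step: "step s e c \<Longrightarrow> complete_run c es \<Longrightarrow> complete_run (Running s) (e # es)"

definition interpretation_of :: "'n stmt \<Rightarrow> 'n event list \<Rightarrow> bool" where
  "interpretation_of p es \<longleftrightarrow> complete_run (Running p) es"

text \<open>\<open>has_phase p x n\<close> is the graph of the phase function, i.e. \<open>\<phi>(x) = n\<close> in the program
  \<open>p\<close>. The value must be the same in all interpretations, and there must be at least one, so
  that it is determined.\<close>

definition has_phase :: "'n stmt \<Rightarrow> 'n \<Rightarrow> nat \<Rightarrow> bool" where
  "has_phase p x n \<longleftrightarrow>
     (\<exists>es. interpretation_of p es) \<and>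
     (\<forall>es. interpretation_of p es \<longrightarrow>
        (\<exists>us vs. es = us @ Exec x # vs \<and> Exec x \<notin> set us \<and> count_list us Tick = n))"

fun unclocked :: "'n stmt \<Rightarrow> 'n stmt" where
  "unclocked (Basic b) = Basic b"
| "unclocked (Advance a) = Basic a"
| "unclocked (Seq s t) = Seq (unclocked s) (unclocked t)"
| "unclocked (Async s) = Async (unclocked s)"
| "unclocked (Finish s) = Finish (unclocked s)"

definition happens_before :: "'n stmt \<Rightarrow> 'n \<Rightarrow> 'n \<Rightarrow> bool" where
  "happens_before p a x \<longleftrightarrow>
     (\<forall>es. interpretation_of (unclocked p) es \<longrightarrow>
        (\<exists>us vs ws. es = us @ Exec a # vs @ Exec x # ws))"

end

theory Submission
  imports Defs
begin

text \<open>In a program without advances, \<open>a\<close> happens before \<open>x\<close> exactly when some subterm \<open>Seq s t\<close>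
  has \<open>x\<close> in \<open>t\<close> and \<open>a\<close> in \<open>s\<close>, with no \<open>Async\<close> of \<open>s\<close> around \<open>a\<close> except below a \<open>Finish\<close>.
  This structural relation is invariant under reduction. An execution step leaves the advances
  alone, and a clock step turns exactly one of the advances preceding any remaining operation \<open>x\<close>
  into a basic statement. Once \<open>x\<close> can execute, nothing precedes it, so the number of clock steps
  taken by then is the number of advances preceding \<open>x\<close> at the start.\<close>

text \<open>The names that must have been executed before \<open>s\<close> becomes asynchronous or terminates.\<close>

fun sync_names :: "'n stmt \<Rightarrow> 'n set" where
  "sync_names (Basic b) = {b}"
| "sync_names (Advance a) = {a}"
| "sync_names (Seq s t) = sync_names s \<union> sync_names t"
| "sync_names (Async s) = {}"
| "sync_names (Finish s) = set (names s)"

text \<open>The \<open>Finish\<close> case adds no pair: a \<open>finish\<close> orders its body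
  only against what follows it, and the \<open>Seq\<close> case reads that off
  \<open>sync_names\<close>.\<close>

fun before :: "'n stmt \<Rightarrow> 'n \<Rightarrow> 'n \<Rightarrow> bool" where
  "before (Basic b) a x \<longleftrightarrow> False"
| "before (Advance b) a x \<longleftrightarrow> False"
| "before (Seq s t) a x \<longleftrightarrow>
     before s a x \<or> before t a x \<or> a \<in> sync_names s \<and> x \<in> set (names t)"
| "before (Async s) a x \<longleftrightarrow> before s a x"
| "before (Finish s) a x \<longleftrightarrow> before s a x"

section \<open>Names and structural precedence\<close>

lemma sync_names_subset: "sync_names s \<subseteq> set (names s)"
  by (induction s) auto

lemma sync_names_asynchronous: "asynchronous s \<Longrightarrow> sync_names s = {}"
  by (induction s) auto

lemma names_eq: "set (names s) = operations s \<union> advances s"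
  by (induction s) auto

lemma operations_advances_disjoint:
  "distinct (names s) \<Longrightarrow> operations s \<inter> advances s = {}"
  by (induction s) (auto simp: names_eq)

lemma before_names: "before s a x \<Longrightarrow> a \<in> set (names s) \<and> x \<in> set (names s)"
  using sync_names_subset by (induction s) fastforce+

lemma before_irrefl: "distinct (names s) \<Longrightarrow> \<not> before s x x"
  using sync_names_subset by (induction s) fastforce+

lemma finite_advances: "finite (advances s)"
  by (induction s) auto

lemma names_unclocked [simp]: "names (unclocked s) = names s"
  by (induction s) auto

lemma advances_unclocked [simp]: "advances (unclocked s) = {}"
  by (induction s) auto

lemma sync_names_unclocked [simp]: "sync_names (unclocked s) = sync_names s"
  by (induction s) auto

lemma before_unclocked [simp]: "before (unclocked s) a x \<longleftrightarrow> before s a x"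
  by (induction s) auto

lemma no_clocked_finish_if_no_advances: "advances s = {} \<Longrightarrow> no_clocked_finish s"
  by (induction s) auto


section \<open>Execution steps\<close>

lemma stuck_advances: "stuck s \<Longrightarrow> advances s \<noteq> {}"
  by (induction rule: stuck.induct) auto

text \<open>Only a single basic statement wrapped in \<open>Async\<close> and \<open>Finish\<close>
  terminates in one step. For \<open>sync_names\<close> there is just an inclusion, since an
  \<open>Async\<close> wrapper empties it.\<close>

lemma step_Done:
  "step s e Done \<Longrightarrow> \<exists>y. e = Exec y \<and> names s = [y] \<and> advances s = {} \<and> sync_names s \<subseteq> {y}"
  by (induction s e "Done :: 'a config" rule: step.induct) auto

lemma step_Exec_operations: "step s (Exec y) c \<Longrightarrow> y \<in> operations s"
  by (induction s "Exec y" c rule: step.induct) auto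

lemma step_Exec_names: "step s (Exec y) c \<Longrightarrow> y \<in> set (names s)"
  using step_Exec_operations names_eq by fastforce

text \<open>A tick inside \<open>s\<close> would need a \<open>Finish\<close> with a stuck body,
  hence an advance in that body. So only the outermost \<open>Finish\<close> of the program can
  tick.\<close>

lemma step_is_Exec:
  "\<lbrakk>step s e c; no_clocked_finish s\<rbrakk> \<Longrightarrow> \<exists>y. e = Exec y"
  by (induction rule: step.induct)
    (auto simp: no_clocked_finish_if_no_advances dest: stuck_advances)

lemma step_advances: "step s (Exec y) (Running s') \<Longrightarrow> advances s' = advances s"
  by (induction s "Exec y" "Running s'" arbitrary: s' rule: step.induct)
    (auto dest: step_Done)

lemma step_no_clocked_finish:
  "\<lbrakk>step s (Exec y) (Running s'); no_clocked_finish s\<rbrakk> \<Longrightarrow> no_clocked_finish s'"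
  by (induction s "Exec y" "Running s'" arbitrary: s' rule: step.induct)
    (auto dest: step_advances)

lemma step_names:
  "step s (Exec y) (Running s') \<Longrightarrow> distinct (names s) \<Longrightarrow>
     distinct (names s') \<and> set (names s') = set (names s) - {y}"
proof (induction s "Exec y" "Running s'" arbitrary: s' rule: step.induct)
  case (step_left s s' t)
  then show ?case using step_Exec_names[OF step_left.hyps(1)] by auto
next
  case (step_right t s s')
  then show ?case using step_Exec_names[OF step_right.hyps(2)] by auto
qed (auto dest!: step_Done)

lemma step_operations:
  "step s (Exec y) (Running s') \<Longrightarrow> x \<in> operations s \<Longrightarrow> x \<noteq> y \<Longrightarrow> x \<in> operations s'"
proof (induction s "Exec y" "Running s'" arbitrary: s' rule: step.induct)
  case (step_left_done s t)
  then show ?case using step_Done[OF step_left_done.hyps(1)] names_eq[of s] by auto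
next
  case (step_right_done t s)
  then show ?case using step_Done[OF step_right_done.hyps(2)] names_eq[of s] by auto
qed auto

text \<open>The side condition on asynchrony matters when a right part terminates: the surviving
  left part has no synchronous names, and the vanished part had at most \<open>y\<close>.\<close>

lemma step_sync_names:
  "step s (Exec y) (Running s') \<Longrightarrow> distinct (names s) \<Longrightarrow> sync_names s' = sync_names s - {y}"
proof (induction s "Exec y" "Running s'" arbitrary: s' rule: step.induct)
  case (step_finish s s')
  then show ?case using step_names[OF step_finish.hyps(1)] by auto
next
  case (step_left s s' t)
  then show ?case
    using step_Exec_names[OF step_left.hyps(1)] sync_names_subset[of t] by auto
next
  case (step_right t s s')
  then show ?case
    using step_Exec_names[OF step_right.hyps(2)] sync_names_subset[of t] by auto
next
  case (step_left_done s t)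
  then show ?case
    using step_Done[OF step_left_done.hyps(1)] sync_names_subset[of t] by auto
next
  case (step_right_done t s)
  then show ?case
    using step_Done[OF step_right_done.hyps(2)] sync_names_asynchronous[of t] by auto
qed auto

lemma before_singleton: "names s = [y] \<Longrightarrow> \<not> before s a x"
  using before_names[of s a x] before_irrefl[of s y] by auto

text \<open>A part dropped on termination carries the single name \<open>y\<close>, so any pair lost
  involves \<open>y\<close>; a surviving \<open>Seq\<close> loses only \<open>y\<close> from its
  names and synchronous names.\<close>

lemma step_before:
  "step s (Exec y) (Running s') \<Longrightarrow> distinct (names s) \<Longrightarrow> a \<noteq> y \<Longrightarrow> x \<noteq> y \<Longrightarrow>
     before s' a x \<longleftrightarrow> before s a x"
proof (induction s "Exec y" "Running s'" arbitrary: s' rule: step.induct)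
  case (step_left s s' t)
  then show ?case using step_sync_names[OF step_left.hyps(1)] by auto
next
  case (step_right t s s')
  then show ?case using step_names[OF step_right.hyps(2)] by auto
next
  case (step_left_done s t)
  then show ?case
    using step_Done[OF step_left_done.hyps(1)] before_singleton[of s] by auto
next
  case (step_right_done t s)
  then show ?case
    using step_Done[OF step_right_done.hyps(2)] before_singleton[of s]
      sync_names_asynchronous[of t] by auto
qed auto

text \<open>At each enclosing \<open>Seq\<close>, the name being executed lies in the left half, or
  the left half is asynchronous and thus has empty \<open>sync_names\<close>.\<close>

lemma not_before_executing:
  "step s (Exec x) c \<Longrightarrow> distinct (names s) \<Longrightarrow> \<not> before s a x"
proof (induction s "Exec x" c rule: step.induct)
  case (step_left s s' t)
  then show ?case using step_Exec_names[OF step_left.hyps(1)] before_names[of t a x] by auto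
next
  case (step_right t s s')
  then show ?case
    using step_Exec_names[OF step_right.hyps(2)] before_names[of t a x]
      sync_names_asynchronous[of t] by auto
next
  case (step_left_done s t)
  then show ?case
    using step_Exec_names[OF step_left_done.hyps(1)] before_names[of t a x] by auto
next
  case (step_right_done t s)
  then show ?case
    using step_Exec_names[OF step_right_done.hyps(2)] before_names[of t a x]
      sync_names_asynchronous[of t] by auto
qed auto


section \<open>Clock steps\<close>

lemma clock_step_names: "clock_step s t \<Longrightarrow> names t = names s"
  by (induction rule: clock_step.induct) auto

lemma clock_step_sync_names: "clock_step s t \<Longrightarrow> sync_names t = sync_names s"
  by (induction rule: clock_step.induct) auto

lemma clock_step_before: "clock_step s t \<Longrightarrow> before t a x \<longleftrightarrow> before s a x"
  by (induction rule: clock_step.induct) (auto simp: clock_step_names clock_step_sync_names)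

lemma clock_step_advances: "clock_step s t \<Longrightarrow> advances t \<subseteq> advances s"
  by (induction rule: clock_step.induct) auto

lemma clock_step_operations: "clock_step s t \<Longrightarrow> operations s \<subseteq> operations t"
  by (induction rule: clock_step.induct) auto

lemma clock_step_no_clocked_finish:
  "clock_step s t \<Longrightarrow> no_clocked_finish s \<Longrightarrow> no_clocked_finish t"
  by (induction rule: clock_step.induct) auto

inductive_cases clock_step_AdvanceE: "clock_step (Advance a) t"
inductive_cases clock_step_AsyncE: "clock_step (Async s) t"
inductive_cases clock_step_SeqE: "clock_step (Seq s u) t"

text \<open>The synchronous thread of control is blocked at exactly one advance. In a
  \<open>Seq\<close> it is found on the left if the left half is synchronous; otherwise the left
  half contributes no synchronous names and the right half is the synchronous one.\<close>

lemma clock_step_fires_sync: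
  "stuck s \<Longrightarrow> clock_step s t \<Longrightarrow> synchronous s \<Longrightarrow> distinct (names s) \<Longrightarrow>
     \<exists>a. (advances s - advances t) \<inter> sync_names s = {a}"
proof (induction arbitrary: t rule: stuck.induct)
  case (stuck_advance a)
  then show ?case by (auto elim: clock_step_AdvanceE)
next
  case (stuck_async s)
  then show ?case by simp
next
  case (stuck_seq_sync s u)
  then obtain s' where t: "t = Seq s' u" and s': "clock_step s s'"
    by (auto elim: clock_step_SeqE)
  obtain a where "(advances s - advances s') \<inter> sync_names s = {a}"
    using stuck_seq_sync.IH[OF s'] stuck_seq_sync.hyps stuck_seq_sync.prems by fastforce
  \<comment> \<open>Distinct names keep the advances fired in \<open>s\<close> out of
    \<open>sync_names u\<close>.\<close>
  moreover have "advances s \<inter> set (names u) = {}"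
    using stuck_seq_sync.prems names_eq[of s] by auto
  ultimately have "(advances (Seq s u) - advances t) \<inter> sync_names (Seq s u) = {a}"
    using t sync_names_subset[of u] by (auto simp: names_eq)
  then show ?case by blast
next
  case (stuck_seq_async s u)
  then obtain s' u' where t: "t = Seq s' u'" and s': "clock_step s s'" and u': "clock_step u u'"
    by (auto elim: clock_step_SeqE)
  obtain a where "(advances u - advances u') \<inter> sync_names u = {a}"
    using stuck_seq_async.IH(2)[OF u'] stuck_seq_async.hyps stuck_seq_async.prems by fastforce
  moreover have "advances s \<inter> set (names u) = {}"
    using stuck_seq_async.prems names_eq[of s] by auto
  ultimately have "(advances (Seq s u) - advances t) \<inter> sync_names (Seq s u) = {a}"
    using t sync_names_subset[of u] sync_names_asynchronous[OF stuck_seq_async.hyps(1)]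
      clock_step_advances[OF s'] by (auto simp: names_eq)
  then show ?case by blast
qed

text \<open>If \<open>x\<close> lies in a half that takes the clock step, that half supplies the
  unique advance. If \<open>x\<close> waits behind a blocked synchronous half, the advance is the
  one from \<open>clock_step_fires_sync\<close>. The base case is vacuous, as an advance contains no
  operation.\<close>

lemma clock_step_fires_before:
  "stuck s \<Longrightarrow> clock_step s t \<Longrightarrow> distinct (names s) \<Longrightarrow> x \<in> operations s \<Longrightarrow>
     \<exists>a. {a \<in> advances s - advances t. before s a x} = {a}"
proof (induction arbitrary: t rule: stuck.induct)
  case (stuck_advance a)
  then show ?case by simp
next
  case (stuck_async s)
  then show ?case by (auto elim!: clock_step_AsyncE)
next
  case (stuck_seq_sync s u)
  then obtain s' where t: "t = Seq s' u" and s': "clock_step s s'"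
    by (auto elim: clock_step_SeqE)
  have disj: "set (names s) \<inter> set (names u) = {}"
    using stuck_seq_sync.prems by auto
  then have diff: "advances (Seq s u) - advances t = advances s - advances s'"
    using t by (auto simp: names_eq)
  show ?case
  proof (cases "x \<in> operations s")
    case True
    with disj have "before (Seq s u) a x \<longleftrightarrow> before s a x" for a
      using before_names[of u a x] by (auto simp: names_eq)
    then show ?thesis using stuck_seq_sync.IH[OF s'] stuck_seq_sync.prems True diff by simp
  next
    case False
    then have x: "x \<in> set (names u)" using stuck_seq_sync.prems by (auto simp: names_eq)
    \<comment> \<open>With \<open>a\<close> and \<open>x\<close> in different halves, only the pairs
      created by this \<open>Seq\<close> itself remain.\<close>
    have "before (Seq s u) a x \<longleftrightarrow> a \<in> sync_names s" if "a \<in> advances s" for a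
      using that x disj before_names[of s a x] before_names[of u a x]
      by (auto simp: names_eq)
    then have "{a \<in> advances (Seq s u) - advances t. before (Seq s u) a x} =
        (advances s - advances s') \<inter> sync_names s"
      unfolding diff by blast
    then show ?thesis
      using clock_step_fires_sync[OF stuck_seq_sync.hyps(2) s' stuck_seq_sync.hyps(1)]
        stuck_seq_sync.prems by simp
  qed
next
  case (stuck_seq_async s u)
  then obtain s' u' where t: "t = Seq s' u'" and s': "clock_step s s'" and u': "clock_step u u'"
    by (auto elim: clock_step_SeqE)
  have disj: "set (names s) \<inter> set (names u) = {}"
    using stuck_seq_async.prems by auto
  \<comment> \<open>Both halves take the clock step, and distinct names keep an advance fired in one
    from occurring in the other.\<close>
  have diff: "advances (Seq s u) - advances t =
      (advances s - advances s') \<union> (advances u - advances u')"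
    using t disj clock_step_advances[OF s'] clock_step_advances[OF u'] by (auto simp: names_eq)
  have before: "before (Seq s u) a x \<longleftrightarrow> before s a x \<or> before u a x" for a
    using sync_names_asynchronous[OF stuck_seq_async.hyps(1)] by simp
  show ?case
  proof (cases "x \<in> operations s")
    case True
    with disj have "{a \<in> advances (Seq s u) - advances t. before (Seq s u) a x} =
        {a \<in> advances s - advances s'. before s a x}"
      unfolding diff before using before_names[of s _ x] before_names[of u _ x]
      by (auto simp: names_eq)
    then show ?thesis using stuck_seq_async.IH(1)[OF s'] stuck_seq_async.prems True by simp
  next
    case False
    then have x: "x \<in> operations u" using stuck_seq_async.prems by auto
    with disj have "{a \<in> advances (Seq s u) - advances t. before (Seq s u) a x} =
        {a \<in> advances u - advances u'. before u a x}"
      unfolding diff before using before_names[of s _ x] before_names[of u _ x]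
      by (auto simp: names_eq)
    then show ?thesis using stuck_seq_async.IH(2)[OF u'] stuck_seq_async.prems x by simp
  qed
qed

section \<open>Counting the preceding advances along a reduction\<close>

definition depth :: "'n stmt \<Rightarrow> 'n \<Rightarrow> nat" where
  "depth s x = card {a \<in> advances s. before s a x}"

lemma depth_clock_step:
  assumes "stuck s" "clock_step s t" "distinct (names s)" "x \<in> operations s"
  shows "depth s x = Suc (depth t x)"
proof -
  obtain a where a: "{a \<in> advances s - advances t. before s a x} = {a}"
    using clock_step_fires_before[OF assms] by blast
  then have "{a \<in> advances s. before s a x} = insert a {a \<in> advances t. before t a x}"
    and "a \<notin> {a \<in> advances t. before t a x}"
    using clock_step_advances[OF assms(2)] clock_step_before[OF assms(2)] by blast+
  then show ?thesis by (simp add: depth_def finite_advances)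
qed

lemma depth_step:
  assumes "step s (Exec y) (Running s')" "distinct (names s)" "x \<noteq> y"
  shows "depth s' x = depth s x"
proof -
  \<comment> \<open>This lets \<open>step_before\<close> apply to every counted advance, since it
    requires a name other than \<open>y\<close>.\<close>
  have "y \<notin> advances s"
    using step_Exec_operations[OF assms(1)] operations_advances_disjoint[OF assms(2)] by blast
  then have "{a \<in> advances s'. before s' a x} = {a \<in> advances s. before s a x}"
    using step_advances[OF assms(1)] step_before[OF assms(1,2) _ assms(3)] by metis
  then show ?thesis by (simp add: depth_def)
qed


section \<open>Complete reduction sequences\<close>

inductive_cases step_FinishE: "step (Finish s) e c"
inductive_cases complete_run_DoneE: "complete_run Done es"

section \<open>Progress and termination\<close>

lemma stuck_clock_step: "stuck s \<Longrightarrow> \<exists>t. clock_step s t"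
  by (induction rule: stuck.induct) (auto intro: clock_step.intros)

lemma progress_left:
  "step s e c \<Longrightarrow> \<exists>c. step (Seq s t) e c"
  by (cases c) (blast intro: step.intros)+

lemma progress_right:
  "asynchronous t \<Longrightarrow> step s e c \<Longrightarrow> \<exists>c. step (Seq t s) e c"
  by (cases c) (blast intro: step.intros)+

text \<open>In a \<open>Seq\<close> whose left half is stuck, either that half is synchronous and
  blocks the whole, or it is asynchronous and the right half decides. A \<open>Finish\<close> with a
  stuck body can tick.\<close>

lemma progress: "stuck s \<or> (\<exists>e c. step s e c)"
proof (induction s)
  case (Seq s t)
  show ?case using Seq progress_left progress_right stuck.intros by metis
next
  case (Async s)
  have "\<exists>e c. step (Async s) e c" if "step s e c" for e c
    using that by (cases c) (blast intro: step.intros)+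
  with Async show ?case by (blast intro: stuck.intros)
next
  case (Finish s)
  have "\<exists>e c. step (Finish s) e c" if "step s e c" for e c
    using that by (cases c) (blast intro: step.intros)+
  with Finish stuck_clock_step show ?case by (blast intro: step_clock)
qed (auto intro: stuck.intros step.intros)

text \<open>Termination measure: an advance outweighs the basic statement that replaces it, so that
  ticks decrease it too.\<close>

fun weight :: "'n stmt \<Rightarrow> nat" where
  "weight (Basic b) = 1"
| "weight (Advance a) = 2"
| "weight (Seq s t) = Suc (weight s + weight t)"
| "weight (Async s) = Suc (weight s)"
| "weight (Finish s) = Suc (weight s)"

lemma weight_clock_step_le: "clock_step s t \<Longrightarrow> weight t \<le> weight s"
  by (induction rule: clock_step.induct) auto

lemma weight_clock_step: "stuck s \<Longrightarrow> clock_step s t \<Longrightarrow> weight t < weight s"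
proof (induction arbitrary: t rule: stuck.induct)
  case (stuck_seq_async s u)
  then show ?case using weight_clock_step_le by (fastforce elim: clock_step_SeqE)
qed (auto elim!: clock_step_AdvanceE clock_step_AsyncE elim: clock_step_SeqE)

lemma weight_step: "step s e (Running s') \<Longrightarrow> weight s' < weight s"
  by (induction s e "Running s'" arbitrary: s' rule: step.induct)
    (auto dest: weight_clock_step)

lemma step_Finish_Running: "step (Finish s) e (Running s') \<Longrightarrow> \<exists>t. s' = Finish t"
  by (auto elim: step_FinishE)

text \<open>A \<open>Finish\<close> is never stuck, so a step always exists, and
  \<open>weight\<close> decreases until \<open>Done\<close>. A bare statement could end up
  stuck.\<close>

lemma complete_run_Finish_exists: "\<exists>es. complete_run (Running (Finish s)) es"
proof (induction "weight s" arbitrary: s rule: less_induct)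
  case less
  have "\<not> stuck (Finish s)" by (auto elim: stuck.cases)
  then obtain e c where st: "step (Finish s) e c" using progress by blast
  show ?case
  proof (cases c)
    case Done
    with st show ?thesis by (blast intro: complete_run.intros)
  next
    case (Running s')
    with st step_Finish_Running obtain t where t: "c = Running (Finish t)" by blast
    with st weight_step[of "Finish s" e "Finish t"] less show ?thesis
      by (fastforce intro: complete_run.intros)
  qed
qed

text \<open>Along a run, \<open>depth\<close> is constant under executions of other names, drops by
  one at each tick, and is zero when \<open>x\<close> executes.\<close>

lemma phase_eq_depth:
  "complete_run c es \<Longrightarrow> c = Running (Finish s) \<Longrightarrow> no_clocked_finish s \<Longrightarrow>
     distinct (names s) \<Longrightarrow> x \<in> operations s \<Longrightarrow>
     \<exists>us vs. es = us @ Exec x # vs \<and> Exec x \<notin> set us \<and> count_list us Tick = depth s x"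
proof (induction arbitrary: s rule: complete_run.induct)
  case complete_done
  then show ?case by simp
next
  case (complete_step s0 e c es)
  then have st: "step (Finish s) e c" by simp
  have now: ?case if "e = Exec x" "step s e c'" for c'
  proof -
    have "depth s x = 0"
      using not_before_executing[of s x c'] that complete_step.prems by (simp add: depth_def)
    then have "e # es = [] @ Exec x # es \<and> Exec x \<notin> set [] \<and> count_list [] Tick = depth s x"
      using that by simp
    then show ?thesis by blast
  qed
  \<comment> \<open>The event \<open>e\<close> is put in front of the prefix given by the induction
    hypothesis; the \<open>Suc\<close> accounts for \<open>e\<close> being a tick.\<close>
  have later: ?case
    if t: "c = Running (Finish t)" "no_clocked_finish t" "distinct (names t)" "x \<in> operations t"
      "e \<noteq> Exec x" "depth s x = (if e = Tick then Suc (depth t x) else depth t x)" for t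
  proof -
    obtain us vs where
      "es = us @ Exec x # vs" "Exec x \<notin> set us" "count_list us Tick = depth t x"
      using complete_step.IH[OF t(1-4)] by blast
    then have "e # es = (e # us) @ Exec x # vs \<and> Exec x \<notin> set (e # us) \<and>
        count_list (e # us) Tick = depth s x"
      using t by auto
    then show ?thesis by blast
  qed
  from st consider
      (run) s' where "c = Running (Finish s')" "step s e (Running s')"
    | (end_run) "c = Done" "step s e Done"
    | (tick) t where "c = Running (Finish t)" "e = Tick" "stuck s" "clock_step s t"
    by (auto elim: step_FinishE)
  then show ?case
  proof cases
    case run
    then obtain y where y: "e = Exec y" using step_is_Exec complete_step.prems by blast
    show ?thesis
    proof (cases "y = x")
      case True
      with run y now show ?thesis by blast
    next
      case False
      then show ?thesis
        using run y later[of s'] complete_step.prems step_no_clocked_finish step_names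
          step_operations depth_step by (metis event.distinct(1) event.inject)
    qed
  next
    case end_run
    then obtain y where y: "e = Exec y" "names s = [y]" using step_Done by blast
    \<comment> \<open>Since \<open>y\<close> is the only name left, the run cannot end without
      executing \<open>x\<close>.\<close>
    then have "x = y" using complete_step.prems names_eq[of s] by auto
    with end_run y now show ?thesis by blast
  next
    case tick
    then show ?thesis
      using later[of t] complete_step.prems clock_step_no_clocked_finish clock_step_names
        clock_step_operations depth_clock_step by (metis event.distinct(1) subsetD)
  qed
qed


section \<open>Happens-before without advances\<close>

lemma complete_run_Exec_names:
  "complete_run c es \<Longrightarrow> c = Running s \<Longrightarrow> advances s = {} \<Longrightarrow> distinct (names s) \<Longrightarrow>
     Exec x \<in> set es \<longleftrightarrow> x \<in> set (names s)"
proof (induction arbitrary: s rule: complete_run.induct)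
  case (complete_step s0 e c es)
  then obtain y where st: "step s (Exec y) c" and y: "e = Exec y"
    using step_is_Exec no_clocked_finish_if_no_advances by blast
  show ?case
  proof (cases c)
    case Done
    with st complete_step.hyps show ?thesis
      using step_Done by (fastforce elim: complete_run_DoneE simp: y)
  next
    case (Running s')
    then show ?thesis
      using st complete_step step_advances step_names step_Exec_names y by fastforce
  qed
qed simp

text \<open>The pair persists until one of its names executes, and
  \<open>not_before_executing\<close> shows that this is not \<open>x\<close>. Once \<open>a\<close>
  has executed, \<open>x\<close> is still present and must occur later.\<close>

lemma before_imp_run_order:
  "complete_run c es \<Longrightarrow> c = Running s \<Longrightarrow> advances s = {} \<Longrightarrow> distinct (names s) \<Longrightarrow>
     before s a x \<Longrightarrow> \<exists>us vs ws. es = us @ Exec a # vs @ Exec x # ws"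
proof (induction arbitrary: s rule: complete_run.induct)
  case (complete_step s0 e c es)
  then obtain y where st: "step s (Exec y) c" and y: "e = Exec y"
    using step_is_Exec no_clocked_finish_if_no_advances by blast
  have neq: "y \<noteq> x" "a \<noteq> x"
    using not_before_executing[OF st] before_irrefl[of s x] complete_step.prems by auto
  have "c \<noteq> Done"
  proof
    assume "c = Done"
    with st have "names s = [y]" using step_Done[of s "Exec y"] by simp
    with before_singleton complete_step.prems(4) show False by fast
  qed
  then obtain s' where c: "c = Running s'" by (cases c) auto
  have s': "advances s' = {}" "distinct (names s')"
    using step_advances[OF st[unfolded c]] step_names[OF st[unfolded c]] complete_step.prems
    by auto
  show ?case
  proof (cases "y = a")
    case True
    have "x \<in> set (names s')"
      using step_names[OF st[unfolded c]] complete_step.prems before_names[of s a x] neq by auto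
    then have "Exec x \<in> set es"
      using complete_run_Exec_names[OF complete_step.hyps(2) c s'] by simp
    then obtain vs ws where "es = vs @ Exec x # ws" by (auto dest: split_list)
    then have "e # es = [] @ Exec a # vs @ Exec x # ws" using y True by simp
    then show ?thesis by blast
  next
    case False
    then have "before s' a x"
      using step_before[OF st[unfolded c], of a x] complete_step.prems neq by simp
    then obtain us vs ws where "es = us @ Exec a # vs @ Exec x # ws"
      using complete_step.IH[OF c s'] by blast
    then have "e # es = (e # us) @ Exec a # vs @ Exec x # ws" by simp
    then show ?thesis by blast
  qed
qed simp

section \<open>Schedules that delay a given name\<close>

lemma progress_Exec:
  assumes "advances s = {}"
  obtains y c where "step s (Exec y) c" "y \<in> set (names s)"
  using assms progress[of s] stuck_advances step_is_Exec no_clocked_finish_if_no_advances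
    step_Exec_names by metis

text \<open>The asynchronous alternative covers cases such as \<open>Async (Basic a)\<close>, whose
  only step executes \<open>a\<close>; a following statement may then run instead.\<close>

lemma avoiding_step_not_sync:
  "advances s = {} \<Longrightarrow> distinct (names s) \<Longrightarrow> a \<in> set (names s) \<Longrightarrow> a \<notin> sync_names s \<Longrightarrow>
     asynchronous s \<or> (\<exists>y c. step s (Exec y) c \<and> y \<noteq> a)"
proof (induction s)
  case (Seq s t)
  show ?case
  proof (cases "a \<in> set (names s)")
    case True
    with Seq have "asynchronous s \<or> (\<exists>y c. step s (Exec y) c \<and> y \<noteq> a)" by simp
    moreover obtain y c where "step t (Exec y) c" "y \<in> set (names t)"
      using progress_Exec[of t] Seq.prems by auto
    moreover have "y \<noteq> a" using True Seq.prems calculation by auto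
    ultimately show ?thesis using progress_left progress_right by metis
  next
    case False
    obtain y c where "step s (Exec y) c" "y \<in> set (names s)"
      using progress_Exec[of s] Seq.prems by auto
    with False show ?thesis using progress_left by metis
  qed
qed auto

text \<open>If \<open>a\<close> is not in the left half of a \<open>Seq\<close>, any step of that
  half avoids it. If only \<open>a\<close> is there, it is not a synchronous name, so the left half
  can avoid it or lets the right half run. If both names are there, induction applies.\<close>

lemma avoiding_step:
  "advances s = {} \<Longrightarrow> distinct (names s) \<Longrightarrow> a \<in> set (names s) \<Longrightarrow> x \<in> set (names s) \<Longrightarrow>
     a \<noteq> x \<Longrightarrow> \<not> before s a x \<Longrightarrow> \<exists>y c. step s (Exec y) c \<and> y \<noteq> a"
proof (induction s)
  case (Seq s t)
  show ?case
  proof (cases "a \<in> set (names s)")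
    case a: True
    show ?thesis
    proof (cases "x \<in> set (names s)")
      case True
      with a Seq have "\<exists>y c. step s (Exec y) c \<and> y \<noteq> a" by simp
      then show ?thesis using progress_left by metis
    next
      case False
      with Seq.prems have "a \<notin> sync_names s" by auto
      with a Seq.prems have "asynchronous s \<or> (\<exists>y c. step s (Exec y) c \<and> y \<noteq> a)"
        using avoiding_step_not_sync[of s a] by simp
      moreover obtain y c where "step t (Exec y) c" "y \<in> set (names t)"
        using progress_Exec[of t] Seq.prems by auto
      moreover have "y \<noteq> a" using a Seq.prems calculation by auto
      ultimately show ?thesis using progress_left progress_right by metis
    qed
  next
    case False
    obtain y c where "step s (Exec y) c" "y \<in> set (names s)"
      using progress_Exec[of s] Seq.prems by auto
    with False show ?thesis using progress_left by metis
  qed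
next
  case (Async s)
  then obtain y c where "step s (Exec y) c" "y \<noteq> a" by auto
  then show ?case by (cases c) (blast intro: step.intros)+
next
  case (Finish s)
  then obtain y c where "step s (Exec y) c" "y \<noteq> a" by auto
  then show ?case by (cases c) (blast intro: step.intros)+
qed auto

text \<open>Steps avoiding \<open>a\<close> are repeated until \<open>x\<close> has executed; any
  completion may follow. The absence of \<open>Exec x\<close> from \<open>vs\<close> makes the
  displayed occurrence the last one.\<close>

lemma not_before_run:
  "advances s = {} \<Longrightarrow> distinct (names s) \<Longrightarrow> a \<in> set (names s) \<Longrightarrow> x \<in> set (names s) \<Longrightarrow>
     a \<noteq> x \<Longrightarrow> \<not> before s a x \<Longrightarrow>
     \<exists>us vs. complete_run (Running (Finish s)) (us @ Exec x # vs) \<and>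
       Exec a \<notin> set us \<and> Exec x \<notin> set vs"
proof (induction "weight s" arbitrary: s rule: less_induct)
  case less
  obtain y c where st: "step s (Exec y) c" "y \<noteq> a" using avoiding_step[OF less.prems] by blast
  \<comment> \<open>Termination in one step would leave room for one name only, but \<open>a\<close>
    and \<open>x\<close> are two.\<close>
  have "c \<noteq> Done"
  proof
    assume "c = Done"
    with st have "names s = [y]" using step_Done[of s "Exec y"] by simp
    with less.prems show False by simp
  qed
  then obtain s' where c: "c = Running s'" by (cases c) auto
  have s': "advances s' = {}" "distinct (names s')" "set (names s') = set (names s) - {y}"
    using step_advances[OF st(1)[unfolded c]] step_names[OF st(1)[unfolded c]] less.prems
    by auto
  have fin: "step (Finish s) (Exec y) (Running (Finish s'))" using st c by (blast intro: step_finish)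
  show ?case
  proof (cases "y = x")
    case True
    obtain es where es: "complete_run (Running (Finish s')) es"
      using complete_run_Finish_exists by blast
    then have "Exec x \<notin> set es"
      using complete_run_Exec_names[OF es refl] s' True by simp
    moreover have "complete_run (Running (Finish s)) ([] @ Exec x # es)"
      using fin es True by (auto intro: complete_run.intros)
    ultimately show ?thesis by (metis empty_iff empty_set)
  next
    case False
    have "weight s' < weight s" using weight_step[OF st(1)[unfolded c]] .
    moreover have "\<not> before s' a x"
      using step_before[OF st(1)[unfolded c], of a x] st less.prems False by simp
    ultimately obtain us vs where us: "complete_run (Running (Finish s')) (us @ Exec x # vs)"
      "Exec a \<notin> set us" "Exec x \<notin> set vs"
      using less.hyps[of s'] s' less.prems st False by blast
    then have "complete_run (Running (Finish s)) ((Exec y # us) @ Exec x # vs)"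
      using fin by (auto intro: complete_run.intros)
    moreover have "Exec a \<notin> set (Exec y # us)" using us st by auto
    ultimately show ?thesis using us(3) by blast
  qed
qed

lemma happens_before_iff_before:
  assumes "distinct (names s)" "a \<in> set (names s)" "x \<in> set (names s)" "a \<noteq> x"
  shows "happens_before (Finish s) a x \<longleftrightarrow> before s a x"
proof
  assume "before s a x"
  then show "happens_before (Finish s) a x"
    using before_imp_run_order[OF _ refl, of "unclocked (Finish s)"] assms(1)
    by (simp add: happens_before_def interpretation_of_def)
next
  assume hb: "happens_before (Finish s) a x"
  show "before s a x"
  proof (rule ccontr)
    assume "\<not> before s a x"
    then obtain us vs where run: "complete_run (Running (Finish (unclocked s))) (us @ Exec x # vs)"
      and us: "Exec a \<notin> set us" and vs: "Exec x \<notin> set vs"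
      using not_before_run[of "unclocked s" a x] assms by auto
    with hb obtain us' vs' ws where "us @ Exec x # vs = us' @ Exec a # vs' @ Exec x # ws"
      by (fastforce simp: happens_before_def interpretation_of_def)
    \<comment> \<open>Every \<open>Exec x\<close> is the displayed one or lies in \<open>us\<close>,
      so an \<open>Exec a\<close> before it would lie in \<open>us\<close>.\<close>
    with us vs assms(4) show False
      by (auto simp: append_eq_append_conv2 Cons_eq_append_conv append_eq_Cons_conv)
  qed
qed

theorem mainTheorem4:
  fixes r :: "'n stmt" and x :: 'n
  assumes "distinctly_named (Finish r)"
    and "no_clocked_finish r"
    and "x \<in> operations (Finish r)"
  shows "has_phase (Finish r) x
           (card {a \<in> advances (Finish r). happens_before (Finish r) a x})"
proof -
  have dist: "distinct (names r)" and x: "x \<in> operations r"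
    using assms(1,3) by (simp_all add: distinctly_named_def)
  \<comment> \<open>An advance and an operation have different names, as
    \<open>happens_before_iff_before\<close> requires.\<close>
  have "happens_before (Finish r) a x \<longleftrightarrow> before r a x" if "a \<in> advances r" for a
    using happens_before_iff_before[OF dist, of a x] that x
      operations_advances_disjoint[OF dist] by (auto simp: names_eq)
  then have "{a \<in> advances (Finish r). happens_before (Finish r) a x} =
      {a \<in> advances r. before r a x}" by auto
  then show ?thesis
    using complete_run_Finish_exists[of r] phase_eq_depth[OF _ refl assms(2) dist x]
    by (simp add: has_phase_def interpretation_of_def depth_def)
qed

end
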